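(* Let $2<p<2^*$ and $f(t)=t^{p-1}$ for $t>0$. Let $0=t_0<t_1<\dots<t_k$ be such that $a(t_i)=0$ for $i=1,\dots,k$ and $a>0$ on $(t_i,t_{i+1})$ for $i=0,\dots,k-1$. Let $g$ be homogeneous of degree $\gamma>0$, i.e. $g(tu)=t^\gamma g(u)$ for all $t>0$ and $u\in C^1_0(\overline\Omega)$. Let $v$ be a positive solution of $$-\Delta v=v^{p-1}\ \text{in }\Omega,\qquad v=0\ \text{on }\partial\Omega,$$ $C_v:=g(v)$, and assume that $$\mu_0:=\lim_{\alpha\to0^+}a(\alpha)\,\alpha^{\frac{2-p}{\gamma}}=0 .$$ For $i=0,\dots,k-1$ set $$\lambda_{0,i}:=C_v^{\frac{p-2}{\gamma}}\max_{\alpha\in[t_i,t_{i+1}]}a(\alpha)\,\alpha^{\frac{2-p}{\gamma}} ,$$ where the expression is given the value $\mu_0=0$ at $\alpha=0$. Then, for each $i=0,\dots,k-1$: (i) If $0<\lambda<\lambda_{0,i}$, then $(\mathcal P_g)$ has at least two solutions $u_{1,i}=s_{1,i}v$ and $u_{2,i}=s_{2,i}v$ in $(t_i,t_{i+1})$ (with $s_{1,i},s_{2,i}>0$). (ii) If $\lambda=\lambda_{0,i}$, then $(\mathcal P_g)$ has at least one solution $u_i=s_iv$ in $(t_i,t_{i+1})$ (with $s_i>0$). (iii) If $\lambda>\lambda_{0,i}$, then $(\mathcal P_g)$ has no solution of the form $u=sv$, $s>0$, in $(t_i,t_{i+1})$. If moreover either $a$ is strictly concave in $(t_i,t_{i+1})$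 and $\gamma+2<p<2^*$, or $\alpha\mapsto\alpha^{\frac{2-p}{\gamma}}a(\alpha)$ is strictly concave in $(t_i,t_{i+1})$, then (i) and (ii) hold with "at least" replaced by "exactly", where exactness is meant among solutions in $(t_i,t_{i+1})$ of the form $u=sv$, $s>0$.
   Context: $\Omega\subset\mathbb R^N$ is a bounded smooth domain, $C^1_0(\overline\Omega)=\{u\in C^1(\overline\Omega):u=0\text{ on }\partial\Omega\}$, and $2^*$ is the critical Sobolev exponent ($2^*=2N/(N-2)$ if $N\ge3$, $2^*=\infty$ if $N\le2$). The function $a:[0,\infty)\to[0,\infty)$ is continuous. The functional $g:C^1_0(\overline\Omega)\to[0,\infty)$ is continuous with $g(0)=0$, and satisfies at least one of: $(g_1)$ whenever $(u_n)\subset C^1_0(\overline\Omega)$ satisfies $|u_n(x)|\to\infty$ for all $x$ in some subset of $\Omega$ of positive measure, $g(u_n)\to\infty$; $(g_2)$ whenever $(u_n)\subset C^1_0(\overline\Omega)$ satisfies $|\nabla u_n(x)|\to\infty$ for all $x$ in some subset of $\Omega$ of positive measure, $g(u_n)\to\infty$. (In particular $C_v>0$.) For $\lambda>0$, $(\mathcal P_g)$ is the problem $$-a(g(u))\,\Delta u=\lambda f(u)\ \text{in }\Omega,\qquad u>0\ \text{in }\Omega,\qquad u=0\ \text{on }\partial\Omega .$$ Solutions are weak solutions, belonging to $C^1_0(\overline\Omega)$. A solution in $(t_i,t_{i+1})$ is a solution $u$ with $t_i<g(u)<t_{i+1}$. *)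

theory Defs
  imports "HOL-Analysis.Analysis"
begin

text \<open>
  \<open>C_k k S f\<close>: all partial derivatives of \<open>f\<close> up to order \<open>k\<close> exist and are continuous on the
  open set \<open>S\<close>, the derivatives of order below \<open>k\<close> being Frechet differentiable there.
\<close>

fun C_k :: "nat \<Rightarrow> 'a::euclidean_space set \<Rightarrow> ('a \<Rightarrow> real) \<Rightarrow> bool" where
  "C_k 0 S f \<longleftrightarrow> continuous_on S f"
| "C_k (Suc k) S f \<longleftrightarrow> (\<forall>x\<in>S. f differentiable (at x)) \<and>
     (\<forall>b\<in>Basis. C_k k S (\<lambda>x. frechet_derivative f (at x) b))"

definition smooth_fun :: "('a::euclidean_space \<Rightarrow> real) \<Rightarrow> bool" where
  "smooth_fun f \<longleftrightarrow> (\<forall>k. C_k k UNIV f)"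

definition grad :: "('a::euclidean_space \<Rightarrow> real) \<Rightarrow> 'a \<Rightarrow> 'a" where
  "grad u x = (\<Sum>b\<in>Basis. frechet_derivative u (at x) b *\<^sub>R b)"

text \<open>
  Near each boundary point \<open>\<Omega>\<close> is the strict epigraph, in some unit direction \<open>e\<close>, of a smooth
  function \<open>\<psi>\<close> of the coordinates orthogonal to \<open>e\<close>. These coordinates are the vector
  \<open>x - (x \<bullet> e) *\<^sub>R e\<close>, so only the restriction of \<open>\<psi>\<close> to the hyperplane orthogonal to \<open>e\<close> matters.
\<close>

definition smooth_boundary :: "'a::euclidean_space set \<Rightarrow> bool" where
  "smooth_boundary \<Omega> \<longleftrightarrow> (\<forall>x0\<in>frontier \<Omega>. \<exists>r>0. \<exists>e \<psi>. norm e = 1 \<and> smooth_fun \<psi> \<and>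
     \<Omega> \<inter> ball x0 r = {x \<in> ball x0 r. \<psi> (x - (x \<bullet> e) *\<^sub>R e) < x \<bullet> e})"

definition bounded_smooth_domain :: "'a::euclidean_space set \<Rightarrow> bool" where
  "bounded_smooth_domain \<Omega> \<longleftrightarrow>
     open \<Omega> \<and> connected \<Omega> \<and> \<Omega> \<noteq> {} \<and> bounded \<Omega> \<and> smooth_boundary \<Omega>"

definition critical_sobolev_exponent :: "nat \<Rightarrow> ereal" where
  "critical_sobolev_exponent N =
     (if N \<ge> 3 then ereal (2 * real N / (real N - 2)) else \<infinity>)"

text \<open>
  A function on the closure of \<open>\<Omega>\<close> vanishing on the boundary is represented by its extension by
  zero to the whole space. Membership in \<open>C^1\<close> up to the boundary means that the function is
  continuous on the closure and its gradient on \<open>\<Omega>\<close> extends continuously to the closure.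
\<close>

definition C10 :: "'a::euclidean_space set \<Rightarrow> ('a \<Rightarrow> real) set" where
  "C10 \<Omega> = {u. (\<forall>x. x \<notin> \<Omega> \<longrightarrow> u x = 0) \<and> continuous_on (closure \<Omega>) u \<and>
     (\<forall>x\<in>\<Omega>. u differentiable (at x)) \<and>
     (\<exists>G. continuous_on (closure \<Omega>) G \<and> (\<forall>x\<in>\<Omega>. G x = grad u x))}"

text \<open>
  By density the suprema over \<open>\<Omega>\<close> agree with those over the closure. The gradient of the zero
  extension need not exist on the boundary, hence the restriction to \<open>\<Omega>\<close>.
\<close>

definition C1_norm :: "'a::euclidean_space set \<Rightarrow> ('a \<Rightarrow> real) \<Rightarrow> real" where
  "C1_norm \<Omega> u = (SUP x\<in>\<Omega>. \<bar>u x\<bar>) + (SUP x\<in>\<Omega>. norm (grad u x))"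

definition C10_continuous ::
    "'a::euclidean_space set \<Rightarrow> (('a \<Rightarrow> real) \<Rightarrow> real) \<Rightarrow> bool" where
  "C10_continuous \<Omega> g \<longleftrightarrow> (\<forall>u\<in>C10 \<Omega>. \<forall>\<epsilon>>0. \<exists>\<delta>>0. \<forall>w\<in>C10 \<Omega>.
     C1_norm \<Omega> (\<lambda>x. w x - u x) < \<delta> \<longrightarrow> \<bar>g w - g u\<bar> < \<epsilon>)"

definition cond_g1 :: "'a::euclidean_space set \<Rightarrow> (('a \<Rightarrow> real) \<Rightarrow> real) \<Rightarrow> bool" where
  "cond_g1 \<Omega> g \<longleftrightarrow> (\<forall>u :: nat \<Rightarrow> 'a \<Rightarrow> real. (\<forall>n. u n \<in> C10 \<Omega>) \<longrightarrow>
     (\<exists>A\<subseteq>\<Omega>. A \<in> sets lebesgue \<and> emeasure lebesgue A > 0 \<and>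
        (\<forall>x\<in>A. filterlim (\<lambda>n. \<bar>u n x\<bar>) at_top sequentially)) \<longrightarrow>
     filterlim (\<lambda>n. g (u n)) at_top sequentially)"

definition cond_g2 :: "'a::euclidean_space set \<Rightarrow> (('a \<Rightarrow> real) \<Rightarrow> real) \<Rightarrow> bool" where
  "cond_g2 \<Omega> g \<longleftrightarrow> (\<forall>u :: nat \<Rightarrow> 'a \<Rightarrow> real. (\<forall>n. u n \<in> C10 \<Omega>) \<longrightarrow>
     (\<exists>A\<subseteq>\<Omega>. A \<in> sets lebesgue \<and> emeasure lebesgue A > 0 \<and>
        (\<forall>x\<in>A. filterlim (\<lambda>n. norm (grad (u n) x)) at_top sequentially)) \<longrightarrow>
     filterlim (\<lambda>n. g (u n)) at_top sequentially)"

definition test_functions :: "'a::euclidean_space set \<Rightarrow> ('a \<Rightarrow> real) set" where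
  "test_functions \<Omega> =
     {\<phi>. smooth_fun \<phi> \<and> (\<exists>K. compact K \<and> K \<subseteq> \<Omega> \<and> (\<forall>x. x \<notin> K \<longrightarrow> \<phi> x = 0))}"

text \<open>
  Positive weak solutions of \<open>- c \<Delta>u = h(u)\<close> in \<open>\<Omega>\<close>, \<open>u = 0\<close> on the boundary, that belong to
  \<open>C10 \<Omega>\<close>, for a real constant \<open>c\<close>.
\<close>

definition positive_weak_solution ::
    "'a::euclidean_space set \<Rightarrow> real \<Rightarrow> (real \<Rightarrow> real) \<Rightarrow> ('a \<Rightarrow> real) \<Rightarrow> bool" where
  "positive_weak_solution \<Omega> c h u \<longleftrightarrow> u \<in> C10 \<Omega> \<and> (\<forall>x\<in>\<Omega>. u x > 0) \<and>
     (\<forall>\<phi>\<in>test_functions \<Omega>.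
        c * (LINT x:\<Omega>|lborel. grad u x \<bullet> grad \<phi> x) = (LINT x:\<Omega>|lborel. h (u x) * \<phi> x))"

definition Pg_solution ::
    "'a::euclidean_space set \<Rightarrow> (real \<Rightarrow> real) \<Rightarrow> (('a \<Rightarrow> real) \<Rightarrow> real) \<Rightarrow> (real \<Rightarrow> real) \<Rightarrow>
     real \<Rightarrow> ('a \<Rightarrow> real) \<Rightarrow> bool" where
  "Pg_solution \<Omega> a g f lam u \<longleftrightarrow>
     positive_weak_solution \<Omega> (a (g u)) (\<lambda>t. lam * f t) u"

definition ray_solutions ::
    "'a::euclidean_space set \<Rightarrow> (real \<Rightarrow> real) \<Rightarrow> (('a \<Rightarrow> real) \<Rightarrow> real) \<Rightarrow> (real \<Rightarrow> real) \<Rightarrow>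
     ('a \<Rightarrow> real) \<Rightarrow> real \<Rightarrow> real \<Rightarrow> real \<Rightarrow> ('a \<Rightarrow> real) set" where
  "ray_solutions \<Omega> a g f v lam l r =
     {u. Pg_solution \<Omega> a g f lam u \<and> l < g u \<and> g u < r \<and> (\<exists>s>0. u = (\<lambda>x. s * v x))}"

text \<open>The value at \<open>0\<close> is the limit of the expression at \<open>0\<close> from the right, assumed to be \<open>0\<close>.\<close>

definition scaled_coeff :: "(real \<Rightarrow> real) \<Rightarrow> real \<Rightarrow> real \<Rightarrow> real \<Rightarrow> real" where
  "scaled_coeff a p \<gamma> \<alpha> = (if \<alpha> = 0 then 0 else a \<alpha> * \<alpha> powr ((2 - p) / \<gamma>))"

definition lambda0 :: "(real \<Rightarrow> real) \<Rightarrow> real \<Rightarrow> real \<Rightarrow> real \<Rightarrow> real \<Rightarrow> real \<Rightarrow> real" where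
  "lambda0 a p \<gamma> C l r =
     C powr ((p - 2) / \<gamma>) * (GREATEST y. y \<in> scaled_coeff a p \<gamma> ` {l..r})"

definition strictly_concave_on :: "real set \<Rightarrow> (real \<Rightarrow> real) \<Rightarrow> bool" where
  "strictly_concave_on S h \<longleftrightarrow> convex S \<and> (\<forall>x\<in>S. \<forall>y\<in>S. \<forall>\<theta>. x \<noteq> y \<and> 0 < \<theta> \<and> \<theta> < 1 \<longrightarrow>
     (1 - \<theta>) * h x + \<theta> * h y < h ((1 - \<theta>) * x + \<theta> * y))"

end

theory Submission
  imports Defs
begin

text \<open>
  On the ray \<open>s * v\<close>, \<open>s > 0\<close>, the nonlocal equation is a scalar equation. Both sides of the weak
  equation for \<open>s * v\<close> are multiples of those for \<open>v\<close>, so \<open>s * v\<close> is a solution if and only if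
  \<open>a (g (s * v)) = lam * s powr (p - 2)\<close> (lemma \<open>positive_weak_solution_scale_iff\<close>). The forward
  direction needs a test function on which the right-hand side does not vanish; such a function is
  built from \<open>exp (- 1 / t)\<close>.

  Homogeneity of \<open>g\<close>, together with \<open>g v > 0\<close> (lemma \<open>homogeneous_functional_pos\<close>), allows
  \<open>\<alpha> = g (s * v) = s powr \<gamma> * g v\<close> to serve as the unknown instead of \<open>s\<close>. The equation becomes
  \<open>q \<alpha> = \<kappa>\<close>, where \<open>q \<alpha> = a \<alpha> * \<alpha> powr ((2 - p) / \<gamma>)\<close> and \<open>\<kappa> = lam * g v powr ((2 - p) / \<gamma>)\<close>, and
  solutions on the ray with \<open>l < g u < r\<close> correspond bijectively to its roots in the interval from
  \<open>l\<close> to \<open>r\<close> (lemma \<open>ray_solutions_eq_image\<close>).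

  On each interval between consecutive \<open>t i\<close> the function \<open>q\<close> is continuous, vanishes at the ends
  and is positive inside. It therefore takes each positive level below its maximum at least twice,
  the maximum at least once, and no higher level. The maximum of \<open>q\<close> is exactly the level that
  belongs to \<open>lam = lambda0\<close>.

  The roots cannot be more numerous if \<open>q\<close> is strictly larger between any two points where it takes
  the same value. This holds under both concavity hypotheses (lemma \<open>scaled_coeff_rises\<close>): for
  strictly concave \<open>q\<close> it is clear, and for strictly concave \<open>a\<close> the equation \<open>q \<alpha> = \<kappa>\<close> compares
  \<open>a\<close> with the convex function \<open>\<kappa> * \<alpha> powr ((p - 2) / \<gamma>)\<close>.
\<close>

section \<open>Smooth bump functions\<close>

text \<open>
  The division by a power of \<open>t\<close> makes the family closed under differentiation up to linear
  combinations, which replaces any explicit formula for the higher derivatives of \<open>exp (- 1 / t)\<close>.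
\<close>

definition flat_exp :: "nat \<Rightarrow> real \<Rightarrow> real" where
  "flat_exp m t = (if t \<le> 0 then 0 else exp (- (1 / t)) / t ^ m)"

text \<open>
  In the variable \<open>1 / t\<close> this is the decay of \<open>exp\<close> against every power at infinity.
\<close>

lemma flat_exp_tendsto_0: "(flat_exp m \<longlongrightarrow> 0) (at 0)"
proof -
  have "((\<lambda>t. inverse t ^ m / exp (inverse t)) \<longlongrightarrow> (0::real)) (at_right 0)"
    by (rule filterlim_compose[OF tendsto_power_div_exp_0 filterlim_inverse_at_top_right])
  then have right: "(flat_exp m \<longlongrightarrow> 0) (at_right 0)"
    by (rule Lim_transform_eventually)
       (auto simp: eventually_at_filter flat_exp_def exp_minus field_simps)
  have left: "(flat_exp m \<longlongrightarrow> 0) (at_left 0)"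
    by (rule Lim_transform_eventually[OF tendsto_const])
       (auto simp: eventually_at_filter flat_exp_def)
  show ?thesis using left right by (simp add: filterlim_at_split)
qed

text \<open>
  Only \<open>t = 0\<close> is delicate: the difference quotient of one member of the family at \<open>0\<close> is the next
  member, so differentiability there is again the vanishing of the limit at \<open>0\<close>.
\<close>

lemma flat_exp_has_derivative:
  "(flat_exp m has_real_derivative flat_exp (m + 2) t - real m * flat_exp (m + 1) t) (at t)"
proof -
  consider "t < 0" | "t = 0" | "t > 0" by linarith
  then show ?thesis
  proof cases
    case 1
    have "((\<lambda>_. 0) has_real_derivative 0) (at t)" by simp
    then have "(flat_exp m has_real_derivative 0) (at t)"
      by (rule has_field_derivative_transform_within_open[where S="{..<0}"])
         (use 1 in \<open>auto simp: flat_exp_def\<close>)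
    then show ?thesis using 1 by (simp add: flat_exp_def)
  next
    case 2
    have "((\<lambda>h. (flat_exp m (0 + h) - flat_exp m 0) / h) \<longlongrightarrow> 0) (at 0)"
      by (rule Lim_transform_eventually[OF flat_exp_tendsto_0[of "m + 1"]])
         (auto simp: eventually_at_filter flat_exp_def)
    then show ?thesis using 2 by (simp add: DERIV_def flat_exp_def)
  next
    case 3
    have pow: "real m * t ^ (m - 1) * t = real m * t ^ m" by (cases m) simp_all
    have "((\<lambda>t. exp (- (1 / t)) / t ^ m) has_real_derivative
        (exp (- (1 / t)) * (1 / t\<^sup>2) * t ^ m - exp (- (1 / t)) * (real m * t ^ (m - 1))) / (t ^ m * t ^ m))
        (at t)"
      using 3 by (auto intro!: derivative_eq_intros simp: power2_eq_square)
    also have "real m * t ^ (m - 1) = real m * t ^ m / t"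
      using pow 3 by (simp add: field_simps)
    also have "(exp (- (1 / t)) * (1 / t\<^sup>2) * t ^ m - exp (- (1 / t)) * (real m * t ^ m / t)) / (t ^ m * t ^ m)
        = exp (- (1 / t)) / t ^ (m + 2) - real m * (exp (- (1 / t)) / t ^ (m + 1))"
      using 3 by (simp add: field_simps power2_eq_square)
    finally have "((\<lambda>t. exp (- (1 / t)) / t ^ m) has_real_derivative
        exp (- (1 / t)) / t ^ (m + 2) - real m * (exp (- (1 / t)) / t ^ (m + 1))) (at t)" .
    then have "(flat_exp m has_real_derivative
        exp (- (1 / t)) / t ^ (m + 2) - real m * (exp (- (1 / t)) / t ^ (m + 1))) (at t)"
      by (rule has_field_derivative_transform_within_open[where S="{0<..}"])
         (use 3 in \<open>auto simp: flat_exp_def\<close>)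
    then show ?thesis using 3 by (simp add: flat_exp_def)
  qed
qed

text \<open>
  A set of functions that contains the radial bumps supported in the ball of radius \<open>r\<close> about \<open>x0\<close>
  and that every directional derivative maps into itself. Smoothness of all its members then needs
  differentiability only. The factors \<open>(x - x0) \<bullet> b\<close> are what the chain rule produces from the
  squared distance.
\<close>

inductive bump_family :: "'a::euclidean_space \<Rightarrow> real \<Rightarrow> ('a \<Rightarrow> real) \<Rightarrow> bool"
  for x0 :: "'a::euclidean_space" and r :: real where
  base: "bump_family x0 r (\<lambda>x. flat_exp m (r\<^sup>2 - (x - x0) \<bullet> (x - x0)))"
| coord: "bump_family x0 r \<phi> \<Longrightarrow> bump_family x0 r (\<lambda>x. ((x - x0) \<bullet> b) * \<phi> x)"
| scale: "bump_family x0 r \<phi> \<Longrightarrow> bump_family x0 r (\<lambda>x. c * \<phi> x)"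
| add: "bump_family x0 r \<phi> \<Longrightarrow> bump_family x0 r \<psi> \<Longrightarrow> bump_family x0 r (\<lambda>x. \<phi> x + \<psi> x)"

lemma bump_family_derivative:
  assumes "bump_family x0 r \<phi>"
  shows "\<exists>D. (\<forall>x. (\<phi> has_derivative D x) (at x)) \<and> (\<forall>b. bump_family x0 r (\<lambda>x. D x b))"
  using assms
proof induction
  case (base m)
  let ?w = "\<lambda>x. r\<^sup>2 - (x - x0) \<bullet> (x - x0)"
  \<comment> \<open>The sums and products are arranged exactly as the introduction rules build them.\<close>
  let ?d = "\<lambda>x. flat_exp (m + 2) (?w x) + (- real m) * flat_exp (m + 1) (?w x)"
  let ?D = "\<lambda>x y. (- 2) * (((x - x0) \<bullet> y) * ?d x)"
  have "((\<lambda>x. flat_exp m (?w x)) has_derivative ?D x) (at x)" for x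
  proof -
    have w: "(?w has_derivative (\<lambda>y. - 2 * ((x - x0) \<bullet> y))) (at x)"
      by (auto intro!: derivative_eq_intros simp: inner_commute)
    show ?thesis
      by (rule has_derivative_eq_rhs[OF DERIV_compose_FDERIV[OF flat_exp_has_derivative w]])
         (auto simp: algebra_simps)
  qed
  moreover have "bump_family x0 r (\<lambda>x. ?D x b)" for b
    by (intro bump_family.intros)
  ultimately show ?case by (intro exI[of _ ?D]) blast
next
  case (coord \<phi> b)
  then obtain D where D: "\<And>x. (\<phi> has_derivative D x) (at x)" "\<And>b. bump_family x0 r (\<lambda>x. D x b)"
    by blast
  let ?D = "\<lambda>x y. ((x - x0) \<bullet> b) * D x y + (y \<bullet> b) * \<phi> x"
  have "((\<lambda>x. ((x - x0) \<bullet> b) * \<phi> x) has_derivative ?D x) (at x)" for x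
    by (auto intro!: derivative_eq_intros D(1))
  moreover have "bump_family x0 r (\<lambda>x. ?D x b')" for b'
    by (intro bump_family.add bump_family.coord bump_family.scale D(2) coord.hyps)
  ultimately show ?case by (intro exI[of _ ?D]) blast
next
  case (scale \<phi> c)
  then obtain D where D: "\<And>x. (\<phi> has_derivative D x) (at x)" "\<And>b. bump_family x0 r (\<lambda>x. D x b)"
    by blast
  show ?case
    by (intro exI[of _ "\<lambda>x y. c * D x y"] conjI allI bump_family.scale D(2)
          has_derivative_mult_right D(1))
next
  case (add \<phi> \<psi>)
  then obtain D E where D: "\<And>x. (\<phi> has_derivative D x) (at x)" "\<And>b. bump_family x0 r (\<lambda>x. D x b)"
    and E: "\<And>x. (\<psi> has_derivative E x) (at x)" "\<And>b. bump_family x0 r (\<lambda>x. E x b)"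
    by blast
  show ?case
    by (intro exI[of _ "\<lambda>x y. D x y + E x y"] conjI allI bump_family.add D(2) E(2)
          has_derivative_add D(1) E(1))
qed

lemma bump_family_smooth:
  assumes "bump_family x0 r \<phi>"
  shows "smooth_fun \<phi>"
proof -
  have "C_k k UNIV \<phi>" for k
    using assms
  proof (induction k arbitrary: \<phi>)
    case 0
    then obtain D where "\<And>x. (\<phi> has_derivative D x) (at x)"
      using bump_family_derivative by blast
    then have "continuous (at x) \<phi>" for x
      using has_derivative_continuous by blast
    then show ?case by (simp add: continuous_at_imp_continuous_on)
  next
    case (Suc k)
    then obtain D where D: "\<And>x. (\<phi> has_derivative D x) (at x)" "\<And>b. bump_family x0 r (\<lambda>x. D x b)"
      using bump_family_derivative by blast
    have eq: "frechet_derivative \<phi> (at x) = D x" for x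
      using frechet_derivative_at[OF D(1)[of x]] by simp
    have "\<phi> differentiable (at x)" for x
      using D(1)[of x] by (auto simp: differentiable_def)
    then show ?case
      using Suc.IH D(2) by (simp add: eq)
  qed
  then show ?thesis by (simp add: smooth_fun_def)
qed

lemma ex_bump_test_function:
  fixes \<Omega> :: "'a::euclidean_space set"
  assumes "open \<Omega>" "x0 \<in> \<Omega>"
  shows "\<exists>\<phi>\<in>test_functions \<Omega>. \<exists>r>0. ball x0 r \<subseteq> \<Omega> \<and> (\<forall>x. \<phi> x \<ge> 0) \<and> (\<forall>x\<in>ball x0 r. \<phi> x > 0)"
proof -
  obtain r where r: "r > 0" "cball x0 r \<subseteq> \<Omega>"
    using assms open_contains_cball by blast
  define \<phi> where "\<phi> = (\<lambda>x. flat_exp 0 (r\<^sup>2 - (x - x0) \<bullet> (x - x0)))"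
  have pos_iff: "r\<^sup>2 - (x - x0) \<bullet> (x - x0) > 0 \<longleftrightarrow> x \<in> ball x0 r" for x
  proof -
    have "(x - x0) \<bullet> (x - x0) < r\<^sup>2 \<longleftrightarrow> norm (x - x0) < r"
      using r(1) norm_lt_square[of "x - x0" r] by (simp add: power2_eq_square)
    then show ?thesis by (simp add: dist_norm norm_minus_commute)
  qed
  have "smooth_fun \<phi>"
    unfolding \<phi>_def by (rule bump_family_smooth[OF bump_family.base])
  moreover have "\<phi> x = 0" if "x \<notin> cball x0 r" for x
  proof -
    have "x \<notin> ball x0 r" using that by auto
    then show ?thesis using pos_iff[of x] by (auto simp: \<phi>_def flat_exp_def)
  qed
  ultimately have "\<phi> \<in> test_functions \<Omega>"
    using r(2) compact_cball unfolding test_functions_def by blast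
  moreover have "\<phi> x > 0" if "x \<in> ball x0 r" for x
    using pos_iff[of x] that by (auto simp: \<phi>_def flat_exp_def)
  moreover have "ball x0 r \<subseteq> \<Omega>" using r(2) ball_subset_cball by blast
  moreover have "\<phi> x \<ge> 0" for x by (auto simp: \<phi>_def flat_exp_def)
  ultimately show ?thesis using r(1) by blast
qed

lemma ex_test_function_integral_pos:
  fixes \<Omega> :: "'a::euclidean_space set" and h :: "'a \<Rightarrow> real"
  assumes "open \<Omega>" "\<Omega> \<noteq> {}" and h: "continuous_on \<Omega> h" "\<And>x. x \<in> \<Omega> \<Longrightarrow> h x > 0"
  shows "\<exists>\<phi>\<in>test_functions \<Omega>. (LINT x:\<Omega>|lborel. h x * \<phi> x) > 0"
proof -
  obtain x0 where "x0 \<in> \<Omega>" using assms by blast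
  from ex_bump_test_function[OF assms(1) this] obtain \<phi> r
    where \<phi>: "\<phi> \<in> test_functions \<Omega>" "r > 0" "ball x0 r \<subseteq> \<Omega>"
      "\<And>x. \<phi> x \<ge> 0" "\<And>x. x \<in> ball x0 r \<Longrightarrow> \<phi> x > 0" by blast
  obtain K where K: "compact K" "K \<subseteq> \<Omega>" "\<And>x. x \<notin> K \<Longrightarrow> \<phi> x = 0"
    using \<phi>(1) unfolding test_functions_def by blast
  have "C_k 0 UNIV \<phi>"
    using \<phi>(1) unfolding test_functions_def smooth_fun_def by blast
  then have cont: "continuous_on UNIV \<phi>" by simp
  let ?F = "\<lambda>x. indicator \<Omega> x *\<^sub>R (h x * \<phi> x)"
  \<comment> \<open>\<open>h\<close> may blow up at the boundary; integrability comes from the compact support of \<open>\<phi>\<close>.\<close>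
  have "set_integrable lborel K (\<lambda>x. h x * \<phi> x)"
    unfolding set_integrable_def
    by (rule borel_integrable_compact[OF K(1)])
       (intro continuous_intros continuous_on_subset[OF h(1) K(2)] continuous_on_subset[OF cont], simp)
  then have "integrable lborel (\<lambda>x. indicator K x *\<^sub>R (h x * \<phi> x))"
    by (simp add: set_integrable_def)
  also have "(\<lambda>x. indicator K x *\<^sub>R (h x * \<phi> x)) = ?F"
    using K by (auto simp: indicator_def fun_eq_iff)
  finally have int: "integrable lborel ?F" .
  have nonneg: "?F x \<ge> 0" for x
    using h(2)[of x] \<phi>(4)[of x] by (auto simp: indicator_def)
  have "integral\<^sup>L lborel ?F \<noteq> 0"
  proof
    assume "integral\<^sup>L lborel ?F = 0"
    then have "AE x in lborel. ?F x = 0"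
      using integral_nonneg_eq_0_iff_AE[OF int] nonneg by simp
    then have "AE x in lborel. x \<notin> ball x0 r"
    proof eventually_elim
      case (elim x)
      show ?case
      proof
        assume "x \<in> ball x0 r"
        then have "h x * \<phi> x > 0" "x \<in> \<Omega>" using \<phi> h(2) by (auto simp: subset_iff)
        then show False using elim by (metis indicator_simps(1) less_irrefl scaleR_one)
      qed
    qed
    then have "ball x0 r \<in> null_sets lborel"
      by (simp add: AE_iff_null_sets)
    then have "negligible (ball x0 r)"
      by (simp add: negligible_iff_null_sets null_sets_completionI)
    then show False using open_not_negligible[of "ball x0 r"] \<phi>(2) by simp
  qed
  moreover have "integral\<^sup>L lborel ?F \<ge> 0" using nonneg by (simp add: integral_nonneg)
  ultimately show ?thesis
    using \<phi>(1) unfolding set_lebesgue_integral_def by (intro bexI[of _ \<phi>]) auto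
qed

section \<open>Scaling a positive weak solution\<close>

lemma grad_scale:
  assumes "u differentiable (at x)"
  shows "grad (\<lambda>x. s * u x) x = s *\<^sub>R grad u x"
proof -
  have "(u has_derivative frechet_derivative u (at x)) (at x)"
    using assms by (simp add: frechet_derivative_works)
  from has_derivative_mult_right[OF this, of s]
  have "frechet_derivative (\<lambda>x. s * u x) (at x) = (\<lambda>b. s * frechet_derivative u (at x) b)"
    by (rule frechet_derivative_at[symmetric])
  then show ?thesis by (simp add: grad_def scaleR_sum_right)
qed

lemma C10_scale:
  assumes "u \<in> C10 \<Omega>"
  shows "(\<lambda>x. s * u x) \<in> C10 \<Omega>"
proof -
  obtain G where G: "continuous_on (closure \<Omega>) G" "\<And>x. x \<in> \<Omega> \<Longrightarrow> G x = grad u x"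
    using assms unfolding C10_def by blast
  have "continuous_on (closure \<Omega>) (\<lambda>x. s *\<^sub>R G x)"
    by (rule continuous_on_scaleR[OF continuous_on_const G(1)])
  moreover have "\<forall>x\<in>\<Omega>. s *\<^sub>R G x = grad (\<lambda>x. s * u x) x"
    using assms G(2) by (simp add: C10_def grad_scale)
  ultimately have "\<exists>G. continuous_on (closure \<Omega>) G \<and> (\<forall>x\<in>\<Omega>. G x = grad (\<lambda>x. s * u x) x)"
    by (intro exI[of _ "\<lambda>x. s *\<^sub>R G x"] conjI)
  moreover have "continuous_on (closure \<Omega>) (\<lambda>x. s * u x)"
    using assms unfolding C10_def by (intro continuous_on_mult_left) simp
  moreover have "(\<lambda>x. s * u x) differentiable (at x)" if "x \<in> \<Omega>" for x
    using assms that unfolding C10_def by (intro differentiable_mult differentiable_const) simp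
  ultimately show ?thesis
    using assms unfolding C10_def by simp
qed

text \<open>
  The weak equation can be read as an identity between real numbers only against a test function that
  sees its right-hand side. A nonnegative bump does, because \<open>v powr q\<close> is positive.
\<close>

lemma positive_weak_solution_test_function:
  assumes "open \<Omega>" "\<Omega> \<noteq> {}" "positive_weak_solution \<Omega> 1 (\<lambda>r. r powr q) v"
  obtains \<phi> where "\<phi> \<in> test_functions \<Omega>" "(LINT x:\<Omega>|lborel. v x powr q * \<phi> x) > 0"
proof -
  have v: "v \<in> C10 \<Omega>" "\<And>x. x \<in> \<Omega> \<Longrightarrow> v x > 0"
    using assms(3) unfolding positive_weak_solution_def by blast+
  have "continuous_on \<Omega> v"
    by (rule continuous_on_subset[OF _ closure_subset]) (use v(1) in \<open>simp add: C10_def\<close>)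
  moreover have "\<forall>x\<in>\<Omega>. v x \<noteq> 0" using v(2) by (metis less_irrefl)
  ultimately have "continuous_on \<Omega> (\<lambda>x. v x powr q)"
    by (intro continuous_on_powr continuous_on_const)
  moreover have "v x powr q > 0" if "x \<in> \<Omega>" for x
    using v(2)[OF that] by simp
  ultimately have "\<exists>\<phi>\<in>test_functions \<Omega>. (LINT x:\<Omega>|lborel. v x powr q * \<phi> x) > 0"
    by (rule ex_test_function_integral_pos[OF assms(1,2)])
  then show thesis using that by (elim bexE)
qed

text \<open>
  Along the ray through \<open>v\<close> the two sides of the weak equation scale by \<open>s\<close> and by
  \<open>s powr (p - 1)\<close>. If \<open>c * s = lam * s powr (p - 1)\<close>, the equation for \<open>s * v\<close> is a multiple of the one
  for \<open>v\<close>; conversely, a test function with nonzero right-hand side forces these factors to agree.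
\<close>

lemma positive_weak_solution_scale_iff:
  fixes f :: "real \<Rightarrow> real"
  assumes \<Omega>: "open \<Omega>" "\<Omega> \<noteq> {}"
    and v: "positive_weak_solution \<Omega> 1 (\<lambda>r. r powr (p - 1)) v"
    and f: "\<And>r. r > 0 \<Longrightarrow> f r = r powr (p - 1)"
    and s: "s > 0"
  shows "positive_weak_solution \<Omega> c (\<lambda>r. lam * f r) (\<lambda>x. s * v x) \<longleftrightarrow> c = lam * s powr (p - 2)"
proof -
  have vC: "v \<in> C10 \<Omega>" and vpos: "\<And>x. x \<in> \<Omega> \<Longrightarrow> v x > 0"
    and weak: "\<And>\<phi>. \<phi> \<in> test_functions \<Omega> \<Longrightarrow>
      (LINT x:\<Omega>|lborel. grad v x \<bullet> grad \<phi> x) = (LINT x:\<Omega>|lborel. v x powr (p - 1) * \<phi> x)"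
    using v unfolding positive_weak_solution_def by simp_all
  have meas: "\<Omega> \<in> sets lborel" using \<Omega>(1) by simp
  have lhs: "(LINT x:\<Omega>|lborel. grad (\<lambda>x. s * v x) x \<bullet> grad \<phi> x)
      = s * (LINT x:\<Omega>|lborel. grad v x \<bullet> grad \<phi> x)" for \<phi>
  proof -
    have "(LINT x:\<Omega>|lborel. grad (\<lambda>x. s * v x) x \<bullet> grad \<phi> x)
        = (LINT x:\<Omega>|lborel. s * (grad v x \<bullet> grad \<phi> x))"
      using vC by (intro set_lebesgue_integral_cong meas) (simp add: C10_def grad_scale)
    then show ?thesis by (simp only: set_integral_mult_right)
  qed
  have rhs: "(LINT x:\<Omega>|lborel. lam * f (s * v x) * \<phi> x)
      = lam * s powr (p - 2) * s * (LINT x:\<Omega>|lborel. v x powr (p - 1) * \<phi> x)" for \<phi>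
  proof -
    have "lam * f (s * v x) * \<phi> x = (lam * s powr (p - 2) * s) * (v x powr (p - 1) * \<phi> x)"
      if "x \<in> \<Omega>" for x
    proof -
      have "f (s * v x) = s powr (p - 1) * v x powr (p - 1)"
        using s vpos[OF that] by (simp add: f powr_mult)
      moreover have "s powr (p - 1) = s powr (p - 2) * s"
        using s powr_add[of s "p - 2" 1] by simp
      ultimately show ?thesis by simp
    qed
    then have "(LINT x:\<Omega>|lborel. lam * f (s * v x) * \<phi> x)
        = (LINT x:\<Omega>|lborel. (lam * s powr (p - 2) * s) * (v x powr (p - 1) * \<phi> x))"
      by (intro set_lebesgue_integral_cong meas) blast
    then show ?thesis by (simp only: set_integral_mult_right)
  qed
  obtain \<phi> where \<phi>: "\<phi> \<in> test_functions \<Omega>" "(LINT x:\<Omega>|lborel. v x powr (p - 1) * \<phi> x) > 0"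
    using positive_weak_solution_test_function[OF \<Omega> v] .
  have "(\<forall>\<phi>\<in>test_functions \<Omega>. c * (LINT x:\<Omega>|lborel. grad (\<lambda>x. s * v x) x \<bullet> grad \<phi> x)
        = (LINT x:\<Omega>|lborel. lam * f (s * v x) * \<phi> x)) \<longleftrightarrow> c = lam * s powr (p - 2)"
    (is "?L \<longleftrightarrow> ?R")
  proof
    assume ?L
    from bspec[OF this \<phi>(1)] have "c * (s * (LINT x:\<Omega>|lborel. grad v x \<bullet> grad \<phi> x))
        = lam * s powr (p - 2) * s * (LINT x:\<Omega>|lborel. v x powr (p - 1) * \<phi> x)"
      by (simp only: lhs rhs)
    then have "c * (s * (LINT x:\<Omega>|lborel. v x powr (p - 1) * \<phi> x))
        = lam * s powr (p - 2) * s * (LINT x:\<Omega>|lborel. v x powr (p - 1) * \<phi> x)"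
      by (simp only: weak[OF \<phi>(1)])
    then have "c * s = lam * s powr (p - 2) * s"
      using \<phi>(2) by (simp only: mult.assoc[symmetric] mult_cancel_right) auto
    then show ?R using s by (simp only: mult_cancel_right) auto
  next
    assume ?R
    show ?L
    proof
      fix \<phi> assume "\<phi> \<in> test_functions \<Omega>"
      from weak[OF this] \<open>?R\<close>
      show "c * (LINT x:\<Omega>|lborel. grad (\<lambda>x. s * v x) x \<bullet> grad \<phi> x)
        = (LINT x:\<Omega>|lborel. lam * f (s * v x) * \<phi> x)"
        unfolding lhs rhs by (simp only: mult.assoc)
    qed
  qed
  moreover have "(\<lambda>x. s * v x) \<in> C10 \<Omega>" by (rule C10_scale[OF vC])
  moreover have "\<forall>x\<in>\<Omega>. s * v x > 0" using s vpos by simp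
  ultimately show ?thesis unfolding positive_weak_solution_def by argo
qed

text \<open>
  If \<open>g v = 0\<close>, homogeneity gives \<open>g (n * v) = 0\<close> for every \<open>n\<close>, while \<open>n * v\<close> blows up on all of
  \<open>\<Omega>\<close> and its gradient blows up wherever that of \<open>v\<close> is nonzero; either coercivity condition is
  contradicted. The gradient of \<open>v\<close> is nonzero on a nonempty open set: if it vanished throughout
  \<open>\<Omega>\<close>, so would the left-hand side of the weak equation for every test function.
\<close>

lemma homogeneous_functional_pos:
  fixes \<Omega> :: "'a::euclidean_space set"
  assumes \<Omega>: "open \<Omega>" "\<Omega> \<noteq> {}"
    and nonneg: "\<And>u. u \<in> C10 \<Omega> \<Longrightarrow> g u \<ge> 0"
    and g12: "cond_g1 \<Omega> g \<or> cond_g2 \<Omega> g"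
    and hom: "\<And>s u. s > 0 \<Longrightarrow> u \<in> C10 \<Omega> \<Longrightarrow> g (\<lambda>x. s * u x) = s powr \<gamma> * g u"
    and v: "positive_weak_solution \<Omega> 1 (\<lambda>r. r powr q) v"
  shows "g v > 0"
proof (rule ccontr)
  have vC: "v \<in> C10 \<Omega>" and vpos: "\<And>x. x \<in> \<Omega> \<Longrightarrow> v x > 0"
    using v unfolding positive_weak_solution_def by auto
  assume "\<not> g v > 0"
  then have "g v = 0" using nonneg[OF vC] by simp
  define w where "w = (\<lambda>n x. real (Suc n) * v x)"
  have wC: "w n \<in> C10 \<Omega>" for n unfolding w_def by (rule C10_scale[OF vC])
  have gw: "g (w n) = 0" for n
    using hom[of "real (Suc n)" v] vC \<open>g v = 0\<close> unfolding w_def by simp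
  have bounded: "\<not> filterlim (\<lambda>n. g (w n)) at_top sequentially"
    unfolding gw filterlim_at_top_dense by (auto intro!: exI[of _ 0])
  have pos_measure: "A \<in> sets lebesgue \<and> emeasure lebesgue A > 0"
    if "open A" "A \<noteq> {}" for A :: "'a set"
  proof -
    have "A \<in> sets lebesgue" using that(1) by (simp add: sets_completionI_sets)
    moreover have "A \<notin> null_sets lebesgue"
      using open_not_negligible[OF that] by (simp add: negligible_iff_null_sets)
    ultimately show ?thesis unfolding null_sets_def zero_less_iff_neq_zero by blast
  qed
  have unbounded: "filterlim (\<lambda>n. real (Suc n) * c) at_top sequentially" if "c > 0" for c :: real
    using filterlim_tendsto_pos_mult_at_top[OF tendsto_const[of c] that
        filterlim_compose[OF filterlim_real_sequentially filterlim_Suc]]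
    by (simp only: mult.commute[of c])
  show False
  proof (cases "cond_g1 \<Omega> g")
    case True
    have "filterlim (\<lambda>n. \<bar>w n x\<bar>) at_top sequentially" if "x \<in> \<Omega>" for x
    proof -
      have "\<bar>w n x\<bar> = real (Suc n) * v x" for n
        using vpos[OF that] by (simp add: w_def)
      then show ?thesis using unbounded[OF vpos[OF that]] by simp
    qed
    then have "filterlim (\<lambda>n. g (w n)) at_top sequentially"
      using pos_measure[OF \<Omega>]
      by (intro True[unfolded cond_g1_def, rule_format] wC exI[of _ \<Omega>]) auto
    then show False using bounded by blast
  next
    case False
    then have g2: "cond_g2 \<Omega> g" using g12 by blast
    define A where "A = {x \<in> \<Omega>. grad v x \<noteq> 0}"
    obtain G where G: "continuous_on (closure \<Omega>) G" "\<And>x. x \<in> \<Omega> \<Longrightarrow> G x = grad v x"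
      using vC unfolding C10_def by blast
    have "continuous_on \<Omega> G" by (rule continuous_on_subset[OF G(1) closure_subset])
    then have "open {x \<in> \<Omega>. G x \<noteq> 0}"
      using continuous_open_preimage[OF _ \<Omega>(1), of G "- {0}"] by (simp add: vimage_def Int_def open_Compl)
    moreover have "{x \<in> \<Omega>. G x \<noteq> 0} = A" using G(2) by (auto simp: A_def)
    ultimately have "open A" by simp
    obtain \<phi> where \<phi>: "\<phi> \<in> test_functions \<Omega>" "(LINT x:\<Omega>|lborel. v x powr q * \<phi> x) > 0"
      using positive_weak_solution_test_function[OF \<Omega> v] .
    have "A \<noteq> {}"
    proof
      assume "A = {}"
      then have "(LINT x:\<Omega>|lborel. grad v x \<bullet> grad \<phi> x) = (LINT x:\<Omega>|lborel. 0)"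
        using \<Omega>(1) by (intro set_lebesgue_integral_cong) (auto simp: A_def)
      also have "\<dots> = 0" by (simp add: set_lebesgue_integral_def)
      finally show False using \<phi> v unfolding positive_weak_solution_def by auto
    qed
    have "filterlim (\<lambda>n. norm (grad (w n) x)) at_top sequentially" if "x \<in> A" for x
    proof -
      have "v differentiable (at x)" "norm (grad v x) > 0"
        using vC that by (auto simp: C10_def A_def)
      then have "norm (grad (w n) x) = real (Suc n) * norm (grad v x)" for n
        unfolding w_def by (simp only: grad_scale norm_scaleR abs_of_nat)
      then show ?thesis using unbounded[OF \<open>norm (grad v x) > 0\<close>] by simp
    qed
    moreover have "A \<subseteq> \<Omega>" by (auto simp: A_def)
    ultimately have "filterlim (\<lambda>n. g (w n)) at_top sequentially"
      using pos_measure[OF \<open>open A\<close> \<open>A \<noteq> {}\<close>]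
      by (intro g2[unfolded cond_g2_def, rule_format] wC exI[of _ A]) auto
    then show False using bounded by blast
  qed
qed

section \<open>Ray solutions as level sets\<close>

definition level_set :: "(real \<Rightarrow> real) \<Rightarrow> real \<Rightarrow> real \<Rightarrow> real \<Rightarrow> real set" where
  "level_set q l r \<kappa> = {\<alpha>. l < \<alpha> \<and> \<alpha> < r \<and> q \<alpha> = \<kappa>}"

text \<open>
  On the ray, the value \<open>\<alpha> = g u\<close> is a coordinate: \<open>u = s * v\<close> with \<open>s = (\<alpha> / g v) powr (1 / \<gamma>)\<close>.
  Substituting this \<open>s\<close> in \<open>a \<alpha> = lam * s powr (p - 2)\<close> and moving the power of \<open>\<alpha>\<close> to the left gives
  an equation for \<open>scaled_coeff\<close> alone.
\<close>

lemma ray_solutions_eq_image: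
  assumes \<Omega>: "open \<Omega>" "\<Omega> \<noteq> {}"
    and v: "positive_weak_solution \<Omega> 1 (\<lambda>r. r powr (p - 1)) v"
    and f: "\<And>r. r > 0 \<Longrightarrow> f r = r powr (p - 1)"
    and hom: "\<And>s u. s > 0 \<Longrightarrow> u \<in> C10 \<Omega> \<Longrightarrow> g (\<lambda>x. s * u x) = s powr \<gamma> * g u"
    and \<gamma>: "\<gamma> > 0" and gv: "g v > 0" and l: "l \<ge> 0"
  defines "e \<equiv> (\<lambda>\<alpha> x. (\<alpha> / g v) powr (1 / \<gamma>) * v x)"
  shows "ray_solutions \<Omega> a g f v lam l r
      = e ` level_set (scaled_coeff a p \<gamma>) l r (lam * g v powr ((2 - p) / \<gamma>))"
    and "inj_on e {0..}"
proof -
  have vC: "v \<in> C10 \<Omega>" and vpos: "\<And>x. x \<in> \<Omega> \<Longrightarrow> v x > 0"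
    using v unfolding positive_weak_solution_def by auto
  have ge: "g (e \<alpha>) = \<alpha>" if "\<alpha> > 0" for \<alpha>
    using hom[of "(\<alpha> / g v) powr (1 / \<gamma>)" v] vC that gv \<gamma> by (simp add: e_def powr_powr)
  have scale: "(\<lambda>x. s * v x) = e (s powr \<gamma> * g v)" if "s > 0" for s
    using that gv \<gamma> by (simp add: e_def powr_powr)
  have sol: "Pg_solution \<Omega> a g f lam (e \<alpha>) \<longleftrightarrow>
      scaled_coeff a p \<gamma> \<alpha> = lam * g v powr ((2 - p) / \<gamma>)" if "\<alpha> > 0" for \<alpha>
  proof -
    have "Pg_solution \<Omega> a g f lam (e \<alpha>) \<longleftrightarrow>
        positive_weak_solution \<Omega> (a \<alpha>) (\<lambda>r. lam * f r) (\<lambda>x. (\<alpha> / g v) powr (1 / \<gamma>) * v x)"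
      by (simp add: Pg_solution_def ge[OF that]) (simp add: e_def)
    also have "\<dots> \<longleftrightarrow> a \<alpha> = lam * ((\<alpha> / g v) powr (1 / \<gamma>)) powr (p - 2)"
      using that gv by (intro positive_weak_solution_scale_iff[OF \<Omega> v f]) auto
    also have "((\<alpha> / g v) powr (1 / \<gamma>)) powr (p - 2) = \<alpha> powr ((p - 2) / \<gamma>) * g v powr ((2 - p) / \<gamma>)"
    proof -
      have "(2 - p) / \<gamma> = - ((p - 2) / \<gamma>)" by (simp add: minus_divide_left)
      then show ?thesis using that gv by (simp add: powr_powr powr_divide powr_minus_divide)
    qed
    also have "a \<alpha> = lam * (\<alpha> powr ((p - 2) / \<gamma>) * g v powr ((2 - p) / \<gamma>)) \<longleftrightarrow>
        a \<alpha> * \<alpha> powr ((2 - p) / \<gamma>) = lam * g v powr ((2 - p) / \<gamma>)"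
    proof -
      have inv: "\<alpha> powr ((p - 2) / \<gamma>) * \<alpha> powr ((2 - p) / \<gamma>) = 1"
        using that by (simp add: powr_add[symmetric] add_divide_distrib[symmetric])
      have "A = L * (X * K) \<longleftrightarrow> A * Y = L * K" if "X * Y = 1" for A L X Y K :: real
        using that by algebra
      then show ?thesis using inv by blast
    qed
    finally show ?thesis using that by (simp add: scaled_coeff_def)
  qed
  show "ray_solutions \<Omega> a g f v lam l r
      = e ` level_set (scaled_coeff a p \<gamma>) l r (lam * g v powr ((2 - p) / \<gamma>))"
  proof (intro equalityI subsetI)
    fix u assume "u \<in> ray_solutions \<Omega> a g f v lam l r"
    then obtain s where u: "Pg_solution \<Omega> a g f lam u" "l < g u" "g u < r" "s > 0"
        "u = (\<lambda>x. s * v x)"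
      unfolding ray_solutions_def by blast
    define \<alpha> where "\<alpha> = s powr \<gamma> * g v"
    have "\<alpha> > 0" using u(4) gv by (simp add: \<alpha>_def)
    moreover have "u = e \<alpha>" using scale[OF u(4)] u(5) by (simp add: \<alpha>_def)
    ultimately show "u \<in> e ` level_set (scaled_coeff a p \<gamma>) l r (lam * g v powr ((2 - p) / \<gamma>))"
      using u(1-3) ge sol unfolding level_set_def by auto
  next
    fix u assume "u \<in> e ` level_set (scaled_coeff a p \<gamma>) l r (lam * g v powr ((2 - p) / \<gamma>))"
    then obtain \<alpha> where \<alpha>: "l < \<alpha>" "\<alpha> < r" "u = e \<alpha>"
        "scaled_coeff a p \<gamma> \<alpha> = lam * g v powr ((2 - p) / \<gamma>)"
      unfolding level_set_def by blast
    have "\<alpha> > 0" using \<alpha>(1) l by simp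
    moreover from this gv have "\<exists>s>0. u = (\<lambda>x. s * v x)"
      unfolding \<alpha>(3) e_def by (intro exI[of _ "(\<alpha> / g v) powr (1 / \<gamma>)"]) simp
    ultimately show "u \<in> ray_solutions \<Omega> a g f v lam l r"
      using \<alpha> ge sol unfolding ray_solutions_def by auto
  qed
  show "inj_on e {0..}"
  proof (rule inj_onI)
    fix \<alpha> \<beta> assume nn: "\<alpha> \<in> {0..}" "\<beta> \<in> {0..}" and "e \<alpha> = e \<beta>"
    obtain x where "x \<in> \<Omega>" using \<Omega>(2) by blast
    with fun_cong[OF \<open>e \<alpha> = e \<beta>\<close>, of x] vpos[of x]
    have "(\<alpha> / g v) powr (1 / \<gamma>) = (\<beta> / g v) powr (1 / \<gamma>)" by (simp add: e_def)
    then have "((\<alpha> / g v) powr (1 / \<gamma>)) powr \<gamma> = ((\<beta> / g v) powr (1 / \<gamma>)) powr \<gamma>" by simp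
    then show "\<alpha> = \<beta>" using nn gv \<gamma> by (simp add: powr_powr)
  qed
qed

section \<open>Level sets of an arch\<close>

lemma continuous_on_scaled_coeff:
  assumes a: "continuous_on {0..} a"
    and lim: "((\<lambda>\<alpha>. a \<alpha> * \<alpha> powr ((2 - p) / \<gamma>)) \<longlongrightarrow> 0) (at_right 0)"
  shows "continuous_on {0..} (scaled_coeff a p \<gamma>)"
  unfolding continuous_on_def
proof
  fix x :: real assume x: "x \<in> {0..}"
  show "(scaled_coeff a p \<gamma> \<longlongrightarrow> scaled_coeff a p \<gamma> x) (at x within {0..})"
  proof (cases "x = 0")
    case True
    have "(scaled_coeff a p \<gamma> \<longlongrightarrow> 0) (at_right 0)"
      by (rule Lim_transform_eventually[OF lim])
         (auto simp: eventually_at_filter scaled_coeff_def)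
    then show ?thesis using True by (simp add: scaled_coeff_def at_within_Ici_at_right)
  next
    case False
    then have "x > 0" using x by simp
    have "(a \<longlongrightarrow> a x) (at x within {0..})" using a x by (simp add: continuous_on_def)
    then have "((\<lambda>\<alpha>. a \<alpha> * \<alpha> powr ((2 - p) / \<gamma>)) \<longlongrightarrow> a x * x powr ((2 - p) / \<gamma>)) (at x within {0..})"
      using \<open>x > 0\<close> by (intro tendsto_intros) auto
    moreover have "eventually (\<lambda>\<alpha>. \<alpha> \<in> {0<..}) (nhds x)"
      using \<open>x > 0\<close> by (intro eventually_nhds_in_open) auto
    then have "eventually (\<lambda>\<alpha>. a \<alpha> * \<alpha> powr ((2 - p) / \<gamma>) = scaled_coeff a p \<gamma> \<alpha>) (at x within {0..})"
      by (auto simp: eventually_at_filter scaled_coeff_def elim: eventually_mono)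
    ultimately show ?thesis
      using Lim_transform_eventually \<open>x > 0\<close> by (fastforce simp: scaled_coeff_def)
  qed
qed

text \<open>
  A function that is positive inside an interval and zero at its endpoints has its maximum inside,
  so that \<open>Greatest\<close> denotes a value really taken there.
\<close>

lemma arch_max_attained:
  fixes q :: "real \<Rightarrow> real"
  assumes "l < r" and q: "continuous_on {l..r} q" "q l = 0" "q r = 0"
    and pos: "\<And>\<alpha>. l < \<alpha> \<Longrightarrow> \<alpha> < r \<Longrightarrow> q \<alpha> > 0"
  obtains m where "l < m" "m < r" "(GREATEST y. y \<in> q ` {l..r}) = q m"
    "\<And>\<alpha>. l \<le> \<alpha> \<Longrightarrow> \<alpha> \<le> r \<Longrightarrow> q \<alpha> \<le> q m"
proof -
  obtain m where m: "m \<in> {l..r}" "\<And>\<alpha>. \<alpha> \<in> {l..r} \<Longrightarrow> q \<alpha> \<le> q m"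
    using continuous_attains_sup[of "{l..r}" q] q(1) \<open>l < r\<close> by auto
  have "q ((l + r) / 2) > 0" "q ((l + r) / 2) \<le> q m"
    using \<open>l < r\<close> by (auto intro!: pos m(2))
  then have "m \<noteq> l" "m \<noteq> r" using q by auto
  moreover have "(GREATEST y. y \<in> q ` {l..r}) = q m"
    using m by (intro Greatest_equality) auto
  ultimately show thesis using that[of m] m by auto
qed

text \<open>
  A level strictly between \<open>0\<close> and the value at \<open>m\<close> is taken on each side of \<open>m\<close>.
\<close>

lemma arch_level_set_two:
  fixes q :: "real \<Rightarrow> real"
  assumes m: "l < m" "m < r" and q: "continuous_on {l..r} q" "q l = 0" "q r = 0"
    and \<kappa>: "0 < \<kappa>" "\<kappa> < q m"
  obtains x y where "x \<in> level_set q l r \<kappa>" "y \<in> level_set q l r \<kappa>" "x < y"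
proof -
  have "\<exists>x\<ge>l. x \<le> m \<and> q x = \<kappa>"
    using m q \<kappa> by (intro IVT') (auto elim: continuous_on_subset)
  then obtain x where x: "l \<le> x" "x \<le> m" "q x = \<kappa>" by blast
  have "\<exists>x\<ge>m. x \<le> r \<and> q x = \<kappa>"
    using m q \<kappa> by (intro IVT2') (auto elim: continuous_on_subset)
  then obtain y where y: "m \<le> y" "y \<le> r" "q y = \<kappa>" by blast
  have "x \<noteq> l" "x \<noteq> m" "y \<noteq> m" "y \<noteq> r" using x y q \<kappa> by auto
  then show thesis using that[of x y] x y m by (auto simp: level_set_def)
qed

text \<open>
  The consequence of strict concavity that bounds the number of points on a level. Unlike concavity
  itself it is shared by both hypotheses of the uniqueness statement: the scaled
  coefficient inherits it from strict concavity of \<open>a\<close> when the power dividing \<open>a\<close> is convex.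
\<close>

definition rises_between_equal_values :: "(real \<Rightarrow> real) \<Rightarrow> real \<Rightarrow> real \<Rightarrow> bool" where
  "rises_between_equal_values q l r \<longleftrightarrow>
     (\<forall>x y z. l < x \<and> x < z \<and> z < y \<and> y < r \<and> q x = q y \<longrightarrow> q x < q z)"

lemma strictly_concave_on_betweenD:
  assumes "strictly_concave_on {l<..<r} h" "l < x" "x < z" "z < y" "y < r"
  obtains \<theta> where "0 < \<theta>" "\<theta> < 1" "z = (1 - \<theta>) * x + \<theta> * y" "(1 - \<theta>) * h x + \<theta> * h y < h z"
proof -
  define \<theta> where "\<theta> = (z - x) / (y - x)"
  have \<theta>: "0 < \<theta>" "\<theta> < 1" using assms by (auto simp: \<theta>_def)
  have "\<theta> * (y - x) = z - x" using assms by (simp add: \<theta>_def)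
  then have z: "z = (1 - \<theta>) * x + \<theta> * y" by (simp add: algebra_simps)
  have "(1 - \<theta>) * h x + \<theta> * h y < h ((1 - \<theta>) * x + \<theta> * y)"
    using assms \<theta> unfolding strictly_concave_on_def by auto
  with that \<theta> z show thesis by metis
qed

text \<open>
  When \<open>scaled_coeff\<close> itself is strictly concave this is immediate. When \<open>a\<close> is, let \<open>\<kappa>\<close> be the common
  value at \<open>x\<close> and \<open>y\<close>, a positive number. There \<open>a\<close> meets \<open>\<kappa> * \<alpha> powr ((p - 2) / \<gamma>)\<close>, which is convex because
  \<open>\<gamma> + 2 < p\<close> makes the exponent exceed \<open>1\<close>. Between the two meeting points the strictly concave
  function lies strictly above the chord and the convex one nowhere above it.
\<close>

lemma scaled_coeff_rises:
  assumes conc: "(strictly_concave_on {l<..<r} a \<and> \<gamma> + 2 < p) \<or>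
      strictly_concave_on {l<..<r} (\<lambda>\<alpha>. \<alpha> powr ((2 - p) / \<gamma>) * a \<alpha>)"
    and pos: "\<And>\<alpha>. l < \<alpha> \<Longrightarrow> \<alpha> < r \<Longrightarrow> a \<alpha> > 0"
    and \<gamma>: "\<gamma> > 0" and l: "l \<ge> 0"
  shows "rises_between_equal_values (scaled_coeff a p \<gamma>) l r"
  unfolding rises_between_equal_values_def
proof (intro allI impI, elim conjE)
  let ?q = "scaled_coeff a p \<gamma>" and ?b = "(p - 2) / \<gamma>"
  fix x y z assume xyz: "l < x" "x < z" "z < y" "y < r" and eq: "?q x = ?q y"
  have qa: "?q \<alpha> = \<alpha> powr ((2 - p) / \<gamma>) * a \<alpha>" if "\<alpha> > 0" for \<alpha>
    using that by (simp add: scaled_coeff_def)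
  have gt0: "x > 0" "y > 0" "z > 0" using xyz l by auto
  have aq: "a \<alpha> = ?q \<alpha> * \<alpha> powr ?b" if "\<alpha> > 0" for \<alpha>
  proof -
    have "\<alpha> powr ((2 - p) / \<gamma>) * \<alpha> powr ?b = 1"
      using that by (simp add: powr_add[symmetric] add_divide_distrib[symmetric])
    then show ?thesis using that by (simp add: qa)
  qed
  show "?q x < ?q z"
    using conc
  proof
    assume "strictly_concave_on {l<..<r} (\<lambda>\<alpha>. \<alpha> powr ((2 - p) / \<gamma>) * a \<alpha>)"
    from strictly_concave_on_betweenD[OF this xyz] obtain \<theta> where
      "(1 - \<theta>) * ?q x + \<theta> * ?q y < ?q z" by (metis qa gt0)
    then show ?thesis unfolding eq by (simp add: algebra_simps)
  next
    assume A: "strictly_concave_on {l<..<r} a \<and> \<gamma> + 2 < p"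
    then obtain \<theta> where \<theta>: "0 < \<theta>" "\<theta> < 1" "z = (1 - \<theta>) * x + \<theta> * y"
        "(1 - \<theta>) * a x + \<theta> * a y < a z"
      using strictly_concave_on_betweenD[OF _ xyz] by metis
    have "?b \<ge> 1" using A \<gamma> by simp
    then have "convex_on {0<..} (\<lambda>x. x powr ?b)" by (rule powr_convex)
    then have conv: "z powr ?b \<le> (1 - \<theta>) * x powr ?b + \<theta> * y powr ?b"
      using convex_onD[of "{0<..}" "\<lambda>x. x powr ?b" \<theta> x y] \<theta> gt0 by simp
    have "?q x > 0" using pos[of x] xyz gt0 by (simp add: qa)
    then have "?q x * z powr ?b \<le> ?q x * ((1 - \<theta>) * x powr ?b + \<theta> * y powr ?b)"
      using conv by simp
    also have "\<dots> = (1 - \<theta>) * a x + \<theta> * a y"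
      using aq[OF gt0(1)] aq[OF gt0(2)] eq by (simp add: algebra_simps)
    also have "\<dots> < ?q z * z powr ?b" using \<theta>(4) aq[OF gt0(3)] by simp
    finally show ?thesis using gt0(3) by simp
  qed
qed

lemma level_set_eq_pair:
  assumes rises: "rises_between_equal_values q l r"
    and xy: "x \<in> level_set q l r \<kappa>" "y \<in> level_set q l r \<kappa>" "x < y"
  shows "level_set q l r \<kappa> = {x, y}"
proof -
  have no_three: False
    if "u \<in> level_set q l r \<kappa>" "v \<in> level_set q l r \<kappa>" "w \<in> level_set q l r \<kappa>" "u < v" "v < w"
    for u v w
    using rises[unfolded rises_between_equal_values_def, rule_format, of u v w] that
    unfolding level_set_def by auto
  have "z = x \<or> z = y" if "z \<in> level_set q l r \<kappa>" for z
    using no_three[of z x y] no_three[of x z y] no_three[of x y z] that xy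
      linorder_less_linear[of z x] linorder_less_linear[of z y] by blast
  then show ?thesis using xy by blast
qed

text \<open>
  Two points at the maximal level would force a still larger value between them.
\<close>

lemma level_set_max_unique:
  assumes rises: "rises_between_equal_values q l r"
    and m: "l < m" "m < r" and max: "\<And>\<alpha>. l \<le> \<alpha> \<Longrightarrow> \<alpha> \<le> r \<Longrightarrow> q \<alpha> \<le> q m"
  shows "level_set q l r (q m) = {m}"
proof -
  have no_two: False if "u \<in> level_set q l r (q m)" "w \<in> level_set q l r (q m)" "u < w" for u w
  proof -
    have "q u < q ((u + w) / 2)"
      using rises[unfolded rises_between_equal_values_def, rule_format, of u "(u + w) / 2" w] that
      unfolding level_set_def by auto
    moreover have "q ((u + w) / 2) \<le> q m"
      using that by (intro max) (auto simp: level_set_def)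
    ultimately show False using that by (simp add: level_set_def)
  qed
  have m_in: "m \<in> level_set q l r (q m)" using m by (simp add: level_set_def)
  have "u = m" if "u \<in> level_set q l r (q m)" for u
    using no_two[OF that m_in] no_two[OF m_in that] by (cases u m rule: linorder_cases) auto
  then show ?thesis using m_in by blast
qed

section \<open>Counting solutions on a ray\<close>

theorem theorem1p5:
  fixes \<Omega> :: "(real ^ 'n) set"
    and a f :: "real \<Rightarrow> real"
    and g :: "((real ^ 'n) \<Rightarrow> real) \<Rightarrow> real"
    and v :: "(real ^ 'n) \<Rightarrow> real"
    and p \<gamma> :: real
    and k :: nat
    and t :: "nat \<Rightarrow> real"
  assumes \<Omega>: "bounded_smooth_domain \<Omega>"
    and a_cont: "continuous_on {0..} a"
    and a_nonneg: "\<And>\<alpha>. \<alpha> \<ge> 0 \<Longrightarrow> a \<alpha> \<ge> 0"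
    and g_nonneg: "\<And>u. u \<in> C10 \<Omega> \<Longrightarrow> g u \<ge> 0"
    and g_cont: "C10_continuous \<Omega> g"
    and g_zero: "g (\<lambda>x. 0) = 0"
    and g12: "cond_g1 \<Omega> g \<or> cond_g2 \<Omega> g"
    and p: "2 < p" "ereal p < critical_sobolev_exponent CARD('n)"
    and f: "\<And>r. r > 0 \<Longrightarrow> f r = r powr (p - 1)"
    and t0: "t 0 = 0"
    and t_less: "\<And>i. i < k \<Longrightarrow> t i < t (Suc i)"
    and a_zero: "\<And>i. 1 \<le> i \<Longrightarrow> i \<le> k \<Longrightarrow> a (t i) = 0"
    and a_pos: "\<And>i \<alpha>. i < k \<Longrightarrow> t i < \<alpha> \<Longrightarrow> \<alpha> < t (Suc i) \<Longrightarrow> a \<alpha> > 0"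
    and \<gamma>: "\<gamma> > 0"
    and g_hom: "\<And>s u. s > 0 \<Longrightarrow> u \<in> C10 \<Omega> \<Longrightarrow> g (\<lambda>x. s * u x) = s powr \<gamma> * g u"
    and v: "positive_weak_solution \<Omega> 1 (\<lambda>r. r powr (p - 1)) v"
    and mu0: "((\<lambda>\<alpha>. a \<alpha> * \<alpha> powr ((2 - p) / \<gamma>)) \<longlongrightarrow> 0) (at_right 0)"
  shows "\<forall>i<k.
    (let l0 = lambda0 a p \<gamma> (g v) (t i) (t (Suc i));
         S = (\<lambda>lam. ray_solutions \<Omega> a g f v lam (t i) (t (Suc i)))
     in (\<forall>lam>0.
           (lam < l0 \<longrightarrow> (\<exists>u1\<in>S lam. \<exists>u2\<in>S lam. u1 \<noteq> u2)) \<and>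
           (lam = l0 \<longrightarrow> (\<exists>u. u \<in> S lam)) \<and>
           (lam > l0 \<longrightarrow> \<not> (\<exists>u. u \<in> S lam))) \<and>
        ((strictly_concave_on {t i<..<t (Suc i)} a \<and> \<gamma> + 2 < p) \<or>
         strictly_concave_on {t i<..<t (Suc i)} (\<lambda>\<alpha>. \<alpha> powr ((2 - p) / \<gamma>) * a \<alpha>) \<longrightarrow>
           (\<forall>lam>0. (lam < l0 \<longrightarrow> card (S lam) = 2) \<and> (lam = l0 \<longrightarrow> (\<exists>!u. u \<in> S lam)))))"
proof (intro allI impI)
  fix i assume i: "i < k"
  let ?l = "t i" and ?r = "t (Suc i)" and ?q = "scaled_coeff a p \<gamma>"
  have lr: "?l < ?r" using t_less i .
  have l: "?l \<ge> 0"
  proof (cases "i = 0")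
    case False
    have "t 0 \<le> t j" if "j \<le> k" for j
      using that
    proof (induction j)
      case (Suc j)
      then show ?case using t_less[of j] by simp
    qed simp
    then show ?thesis using t0 i by auto
  qed (simp add: t0)
  have \<Omega>': "open \<Omega>" "\<Omega> \<noteq> {}" using \<Omega> by (auto simp: bounded_smooth_domain_def)
  have C: "g v > 0" by (rule homogeneous_functional_pos[OF \<Omega>' g_nonneg g12 g_hom v])
  let ?e = "\<lambda>\<alpha> x. (\<alpha> / g v) powr (1 / \<gamma>) * v x"
  let ?L = "\<lambda>lam. level_set ?q ?l ?r (lam * g v powr ((2 - p) / \<gamma>))"
  have S: "ray_solutions \<Omega> a g f v lam ?l ?r = ?e ` ?L lam" for lam
    by (rule ray_solutions_eq_image(1)[OF \<Omega>' v f g_hom \<gamma> C l])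
  have inj: "inj_on ?e (?L lam)" for lam
    by (rule inj_on_subset[OF ray_solutions_eq_image(2)[OF \<Omega>' v f g_hom \<gamma> C l]])
       (use l in \<open>auto simp: level_set_def\<close>)
  \<comment> \<open>\<open>?q\<close> is an arch: it vanishes at \<open>t 0 = 0\<close> by convention, at the other \<open>t i\<close> because \<open>a\<close> does.\<close>
  have cont: "continuous_on {?l..?r} ?q"
    by (rule continuous_on_subset[OF continuous_on_scaled_coeff[OF a_cont mu0]]) (use l in auto)
  have ql: "?q ?l = 0" using a_zero[of i] t0 i by (cases "i = 0") (auto simp: scaled_coeff_def)
  have qr: "?q ?r = 0" using a_zero[of "Suc i"] i by (auto simp: scaled_coeff_def)
  have qpos: "?q \<alpha> > 0" if "?l < \<alpha>" "\<alpha> < ?r" for \<alpha>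
    using a_pos[OF i that] that l by (simp add: scaled_coeff_def)
  obtain m where m: "?l < m" "m < ?r" "(GREATEST y. y \<in> ?q ` {?l..?r}) = ?q m"
    "\<And>\<alpha>. ?l \<le> \<alpha> \<Longrightarrow> \<alpha> \<le> ?r \<Longrightarrow> ?q \<alpha> \<le> ?q m"
    using arch_max_attained[OF lr cont ql qr qpos] by blast
  \<comment> \<open>In terms of levels, the threshold \<open>l0\<close> corresponds exactly to the maximum of \<open>?q\<close>.\<close>
  define l0 where "l0 = lambda0 a p \<gamma> (g v) ?l ?r"
  have powr_flip: "g v powr ((p - 2) / \<gamma>) = 1 / g v powr ((2 - p) / \<gamma>)"
    using C by (simp add: powr_minus_divide[symmetric] minus_divide_left)
  have l0: "l0 * g v powr ((2 - p) / \<gamma>) = ?q m"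
    using C by (simp add: l0_def lambda0_def m(3) powr_flip)
  have l0_iff: "lam < l0 \<longleftrightarrow> lam * g v powr ((2 - p) / \<gamma>) < ?q m" for lam
    using C by (simp add: l0[symmetric])
  have two: "\<exists>x y. x \<in> ?L lam \<and> y \<in> ?L lam \<and> x < y" if "lam > 0" "lam < l0" for lam
  proof -
    have "0 < lam * g v powr ((2 - p) / \<gamma>)" using that C by simp
    then show ?thesis using that l0_iff
      by (metis arch_level_set_two[OF m(1,2) cont ql qr])
  qed
  have one: "m \<in> ?L l0" using m(1,2) by (simp add: level_set_def l0)
  have none: "?L lam = {}" if "lam > l0" for lam
  proof -
    have gt: "lam * g v powr ((2 - p) / \<gamma>) > ?q m" using that C by (simp add: l0[symmetric])
    show ?thesis
    proof (rule equals0I)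
      fix \<alpha> assume "\<alpha> \<in> ?L lam"
      then show False using m(4)[of \<alpha>] gt by (simp add: level_set_def)
    qed
  qed
  have rises: "rises_between_equal_values ?q ?l ?r"
    if "(strictly_concave_on {?l<..<?r} a \<and> \<gamma> + 2 < p) \<or>
         strictly_concave_on {?l<..<?r} (\<lambda>\<alpha>. \<alpha> powr ((2 - p) / \<gamma>) * a \<alpha>)"
    by (rule scaled_coeff_rises[OF that a_pos[OF i] \<gamma> l])
  show "let l0 = lambda0 a p \<gamma> (g v) (t i) (t (Suc i));
         S = (\<lambda>lam. ray_solutions \<Omega> a g f v lam (t i) (t (Suc i)))
     in (\<forall>lam>0.
           (lam < l0 \<longrightarrow> (\<exists>u1\<in>S lam. \<exists>u2\<in>S lam. u1 \<noteq> u2)) \<and>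
           (lam = l0 \<longrightarrow> (\<exists>u. u \<in> S lam)) \<and>
           (lam > l0 \<longrightarrow> \<not> (\<exists>u. u \<in> S lam))) \<and>
        ((strictly_concave_on {t i<..<t (Suc i)} a \<and> \<gamma> + 2 < p) \<or>
         strictly_concave_on {t i<..<t (Suc i)} (\<lambda>\<alpha>. \<alpha> powr ((2 - p) / \<gamma>) * a \<alpha>) \<longrightarrow>
           (\<forall>lam>0. (lam < l0 \<longrightarrow> card (S lam) = 2) \<and> (lam = l0 \<longrightarrow> (\<exists>!u. u \<in> S lam))))"
    unfolding Let_def S l0_def[symmetric]
  proof (intro conjI allI impI)
    fix lam :: real assume lam: "lam > 0"
    show "\<exists>u1\<in>?e ` ?L lam. \<exists>u2\<in>?e ` ?L lam. u1 \<noteq> u2" if below: "lam < l0"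
    proof -
      obtain x y where xy: "x \<in> ?L lam" "y \<in> ?L lam" "x < y" using two[OF lam below] by blast
      then have "?e x \<noteq> ?e y" using inj_on_eq_iff[OF inj xy(1,2)] by simp
      then show ?thesis using xy(1,2) by blast
    qed
    show "\<exists>u. u \<in> ?e ` ?L lam" if "lam = l0" using one that by blast
    show "\<not> (\<exists>u. u \<in> ?e ` ?L lam)" if "lam > l0" using none[OF that] by simp
    assume conc: "(strictly_concave_on {t i<..<t (Suc i)} a \<and> \<gamma> + 2 < p) \<or>
         strictly_concave_on {t i<..<t (Suc i)} (\<lambda>\<alpha>. \<alpha> powr ((2 - p) / \<gamma>) * a \<alpha>)"
    show "card (?e ` ?L lam) = 2" if below: "lam < l0"
    proof -
      obtain x y where xy: "x \<in> ?L lam" "y \<in> ?L lam" "x < y" using two[OF lam below] by blast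
      show ?thesis
        using level_set_eq_pair[OF rises[OF conc] xy] xy(3) card_image[OF inj[of lam]] by simp
    qed
    show "\<exists>!u. u \<in> ?e ` ?L lam" if "lam = l0"
      using level_set_max_unique[OF rises[OF conc] m(1,2,4)] that by (simp add: l0)
  qed
qed

end
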